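(* Let $D$ be a strongly connected digraph with $n\geq 4$ vertices in which every vertex has degree at least $\frac{n+2}{2}$. Then $D$ has at least two noncritical vertices.
   Context: Digraphs are finite, without loops and without multiple arcs: any two distinct vertices $x$ and $y$ are connected by at most two arcs, at most one in each direction (both arcs $xy$ and $yx$ may be present simultaneously). Two distinct vertices are adjacent if there is at least one arc between them, in either direction. A digraph is strongly connected if for any two of its vertices $x,y$ there is a directed path from $x$ to $y$. The degree $\deg(x)$ of a vertex $x$ in $D$ is the number of vertices adjacent to $x$; if $x$ and $y$ are connected by two arcs, then $y$ is counted once. $D-v$ denotes the digraph obtained from $D$ by deleting the vertex $v$ and all arcs incident to $v$. A vertex $v$ of a strongly connected digraph $D$ is called noncritical if the digraph $D-v$ is strongly connected. *)

theory Defs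
  imports Complex_Main "Graph_Theory.Digraph_Component"
begin

definition adjacent :: "('a,'b) pre_digraph \<Rightarrow> 'a \<Rightarrow> 'a \<Rightarrow> bool" where
  "adjacent D x y \<longleftrightarrow> x \<noteq> y \<and> (x \<rightarrow>\<^bsub>D\<^esub> y \<or> y \<rightarrow>\<^bsub>D\<^esub> x)"

text \<open>
  The degree counts adjacent vertices rather than incident arcs, so it differs from the sum of
  the library's \<^const>\<open>in_degree\<close> and \<^const>\<open>out_degree\<close>
  whenever two vertices are joined by arcs in both directions.
\<close>
definition vdegree :: "('a,'b) pre_digraph \<Rightarrow> 'a \<Rightarrow> nat" where
  "vdegree D x = card {y \<in> verts D. adjacent D x y}"

definition noncritical :: "('a,'b) pre_digraph \<Rightarrow> 'a \<Rightarrow> bool" where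
  "noncritical D v \<longleftrightarrow> v \<in> verts D \<and> strongly_connected (pre_digraph.del_vert D v)"

end

(* Fix a vertex w; we look for a noncritical u different from w.  A shortest ear on a maximal proper
   strong set S covers the complement of S.  If it had at least three vertices, its inner vertices
   would not be adjacent to S, and their degrees would conflict with those of the vertices of S.
   So S misses either one (noncritical) vertex, or the two ends of an arc g -> f that is the only
   arc leaving g and the only arc entering f (a thin arc).  Let G and F be the sets of tails and
   heads of all thin arcs avoiding w.  By counting degrees, any f in F and g in G have at least
   two common middle vertices k with f -> k -> g outside of F and G, so F and G stay in one strong
   component after deleting any single vertex u outside of them.  For fixed f and g, at most one
   such k blocks all walks from F to w and at most one blocks all walks from w to G; some other
   middle vertex u leaves F, G and w in one component C of D - u.  A maximal proper strong set
   containing C cannot miss a thin arc, so it misses a single vertex, different from w. *)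
theory Submission
  imports Defs
begin

section \<open>Strong vertex sets and walks confined to a set\<close>

definition strong :: "'a rel \<Rightarrow> 'a set \<Rightarrow> bool" where
  "strong E X \<longleftrightarrow> (\<forall>x\<in>X. \<forall>y\<in>X. (x, y) \<in> rtrancl_on X E)"

text \<open>As a set, this counts a vertex joined by two opposite arcs once, so its cardinality is
  the degree in the sense of the theorem.\<close>

definition nbrs :: "'a rel \<Rightarrow> 'a \<Rightarrow> 'a set" where
  "nbrs E v = E `` {v} \<union> E\<inverse> `` {v}"

lemma nbrs_converse: "nbrs (E\<inverse>) v = nbrs E v"
  by (auto simp: nbrs_def)

lemma rtrancl_on_converse_iff: "(x, y) \<in> rtrancl_on X (E\<inverse>) \<longleftrightarrow> (y, x) \<in> rtrancl_on X E"
  using rtrancl_on_converseI rtrancl_on_converseD by metis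

lemma rtrancl_on_edge: "(x, y) \<in> E \<Longrightarrow> x \<in> X \<Longrightarrow> y \<in> X \<Longrightarrow> (x, y) \<in> rtrancl_on X E"
  by (rule rtrancl_on_into_rtrancl_on[OF rtrancl_on_refl])

lemma strong_extend:
  assumes "strong E S" "S \<subseteq> X"
    and "\<And>x. x \<in> X \<Longrightarrow> \<exists>s\<in>S. (s, x) \<in> rtrancl_on X E"
    and "\<And>x. x \<in> X \<Longrightarrow> \<exists>s\<in>S. (x, s) \<in> rtrancl_on X E"
  shows "strong E X"
  unfolding strong_def
proof (intro ballI)
  fix x y assume "x \<in> X" "y \<in> X"
  then obtain s t where "s \<in> S" "(x, s) \<in> rtrancl_on X E" "t \<in> S" "(t, y) \<in> rtrancl_on X E"
    using assms by meson
  moreover have "(s, t) \<in> rtrancl_on X E"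
    using assms(1,2) calculation rtrancl_on_mono[of E E S X] by (auto simp: strong_def)
  ultimately show "(x, y) \<in> rtrancl_on X E" by (meson rtrancl_on_trans)
qed

text \<open>A walk in \<open>X\<close> between two members of the class never leaves the class:
  \<open>c\<close> reaches each vertex on it through the start, and each reaches \<open>c\<close>
  through the end.\<close>

lemma strong_component:
  assumes "c \<in> X"
  shows "strong E {x. (c, x) \<in> rtrancl_on X E \<and> (x, c) \<in> rtrancl_on X E}" (is "strong E ?C")
proof -
  have "(x, y) \<in> rtrancl_on ?C E"
    if "(x, y) \<in> rtrancl_on X E" "(c, x) \<in> rtrancl_on X E" "(y, c) \<in> rtrancl_on X E" for x y
    using that
  proof (induction rule: converse_rtrancl_on_induct)
    case base
    then show ?case by auto
  next
    case (step x z)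
    then have "(c, z) \<in> rtrancl_on X E" "(x, c) \<in> rtrancl_on X E"
      by (meson rtrancl_on_into_rtrancl_on converse_rtrancl_on_into_rtrancl_on rtrancl_on_trans)+
    with step show ?case
      by (intro converse_rtrancl_on_into_rtrancl_on[of x z]) auto
  qed
  then show ?thesis
    unfolding strong_def by (auto intro: rtrancl_on_trans)
qed

lemma successively_reach:
  assumes "successively (\<lambda>x y. (x, y) \<in> E) p" "set p \<subseteq> X" "x \<in> set p"
  shows "(hd p, x) \<in> rtrancl_on X E \<and> (x, last p) \<in> rtrancl_on X E"
  using assms
proof (induction p arbitrary: x)
  case (Cons a p)
  show ?case
  proof (cases "p = []")
    case False
    then have e: "(a, hd p) \<in> rtrancl_on X E"
      using Cons.prems False hd_in_set[OF False]
      by (intro rtrancl_on_edge) (auto simp: successively_Cons)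
    have IH: "(hd p, y) \<in> rtrancl_on X E \<and> (y, last p) \<in> rtrancl_on X E" if "y \<in> set p" for y
      using Cons that by (auto simp: successively_Cons)
    show ?thesis
    proof (cases "x = a")
      case True
      then show ?thesis using e IH[of "hd p"] False Cons.prems by (auto intro: rtrancl_on_trans)
    next
      case False
      then show ?thesis using e IH[of x] \<open>p \<noteq> []\<close> Cons.prems by (auto intro: rtrancl_on_trans)
    qed
  qed (use Cons.prems in auto)
qed simp

section \<open>Ears of a strong set\<close>

text \<open>Only the vertices outside \<open>S\<close> are listed. The two attachment vertices in
  \<open>S\<close> may coincide, and the list may repeat vertices.\<close>

definition ear :: "'a rel \<Rightarrow> 'a set \<Rightarrow> 'a set \<Rightarrow> 'a list \<Rightarrow> bool" where
  "ear E V S p \<longleftrightarrow> p \<noteq> [] \<and> set p \<subseteq> V - S \<and> successively (\<lambda>x y. (x, y) \<in> E) p \<and>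
     (\<exists>s\<in>S. (s, hd p) \<in> E) \<and> (\<exists>s\<in>S. (last p, s) \<in> E)"

text \<open>The walk is cut just before it first enters \<open>S\<close>.\<close>

lemma path_to_set:
  assumes "(t, s) \<in> rtrancl_on V E" "t \<in> V - S" "s \<in> S"
  shows "\<exists>p. p \<noteq> [] \<and> hd p = t \<and> set p \<subseteq> V - S \<and> successively (\<lambda>x y. (x, y) \<in> E) p \<and>
     (\<exists>s\<in>S. (last p, s) \<in> E)"
  using assms
proof (induction rule: converse_rtrancl_on_induct)
  case (step x y)
  show ?case
  proof (cases "y \<in> S")
    case True
    then show ?thesis using step by (intro exI[of _ "[x]"]) auto
  next
    case False
    then obtain p where "p \<noteq> []" "hd p = y" "set p \<subseteq> V - S" "successively (\<lambda>x y. (x, y) \<in> E) p"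
      "\<exists>s\<in>S. (last p, s) \<in> E" using step by auto
    then show ?thesis using step by (intro exI[of _ "x # p"]) (auto simp: successively_Cons)
  qed
qed auto

text \<open>Some arc leaves \<open>S\<close>, and a walk from its head back to \<open>S\<close>
  completes the ear.\<close>

lemma ear_exists:
  assumes "strong E V" "S \<subseteq> V" "S \<noteq> {}" "S \<noteq> V"
  shows "\<exists>p. ear E V S p"
proof -
  obtain s t where st: "s \<in> S" "t \<in> V - S" using assms by auto
  have "\<exists>a\<in>S. \<exists>b\<in>V - S. (a, b) \<in> E" if "(s, t) \<in> rtrancl_on V E"
    using that st(2)
  proof (induction rule: rtrancl_on_induct)
    case (step y z)
    then show ?case by (cases "y \<in> S") auto
  qed (use st in auto)
  then obtain a b where ab: "a \<in> S" "b \<in> V - S" "(a, b) \<in> E"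
    using assms st by (auto simp: strong_def)
  have "(b, s) \<in> rtrancl_on V E" using assms st ab by (auto simp: strong_def)
  from path_to_set[OF this ab(2) st(1)] show ?thesis
    using ab by (auto simp: ear_def)
qed

lemma ear_strong:
  assumes "strong E S" "ear E V S p"
  shows "strong E (S \<union> set p)"
proof (rule strong_extend[OF assms(1)])
  let ?X = "S \<union> set p"
  from assms(2) obtain s t where st: "s \<in> S" "(s, hd p) \<in> E" "t \<in> S" "(last p, t) \<in> E"
    and p: "p \<noteq> []" "successively (\<lambda>x y. (x, y) \<in> E) p"
    by (auto simp: ear_def)
  have "(s, hd p) \<in> rtrancl_on ?X E" "(last p, t) \<in> rtrancl_on ?X E"
    using st p by (auto intro!: rtrancl_on_edge)
  moreover have "(hd p, x) \<in> rtrancl_on ?X E \<and> (x, last p) \<in> rtrancl_on ?X E" if "x \<in> set p" for x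
    using successively_reach[OF p(2) _ that, of ?X] by auto
  ultimately have *: "(s, x) \<in> rtrancl_on ?X E" "(x, t) \<in> rtrancl_on ?X E" if "x \<in> set p" for x
    using that by (meson rtrancl_on_trans)+
  show "\<exists>s\<in>S. (s, x) \<in> rtrancl_on ?X E" if "x \<in> ?X" for x
    using that * st by (cases "x \<in> S") auto
  show "\<exists>s\<in>S. (x, s) \<in> rtrancl_on ?X E" if "x \<in> ?X" for x
    using that * st by (cases "x \<in> S") auto
qed auto

text \<open>Otherwise the part of the list before or after \<open>x\<close> could be dropped,
  leaving a shorter ear.\<close>

lemma shortest_ear_inner:
  assumes "ear E V S p" and min: "\<forall>q. ear E V S q \<longrightarrow> length p \<le> length q"
    and "x \<in> set p" "s \<in> S"
  shows "(s, x) \<in> E \<Longrightarrow> x = hd p" "(x, s) \<in> E \<Longrightarrow> x = last p"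
proof -
  from split_list[OF assms(3)] obtain ys zs where p: "p = ys @ x # zs" by auto
  show "x = hd p" if "(s, x) \<in> E"
  proof -
    have "ear E V S (x # zs)"
      using assms(1,4) that unfolding p by (auto simp: ear_def successively_append_iff)
    with min have "ys = []" by (auto simp: p)
    then show ?thesis by (simp add: p)
  qed
  show "x = last p" if "(x, s) \<in> E"
  proof -
    have "ear E V S (ys @ [x])"
      using assms(1,4) that unfolding p
      by (cases "ys = []") (auto simp: ear_def successively_append_iff)
    with min have "zs = []" by (auto simp: p)
    then show ?thesis by (simp add: p)
  qed
qed

section \<open>Walks that survive the deletion of a vertex\<close>

text \<open>The vertex \<open>r\<close> is the last vertex of a walk from \<open>M\<close> to \<open>w\<close> that lies in \<open>R\<close>.\<close>
lemma reach_avoiding: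
  assumes "(m, w) \<in> rtrancl_on V E" "m \<in> M" "w \<notin> M" "E `` M \<subseteq> M \<union> R"
  shows "\<exists>r\<in>R. (w \<in> R \<longrightarrow> r = w) \<and> (\<forall>u\<in>R - {r}. (r, w) \<in> rtrancl_on (V - {u}) E)"
proof (cases "w \<in> R")
  case True
  then show ?thesis using assms by (auto dest: in_rtrancl_on_in_F)
next
  case False
  \<comment> \<open>Going backwards from \<open>w\<close>, either the last vertex in
    \<open>R\<close> has been met, or the walk from \<open>x\<close> on avoids \<open>M\<close> and
    \<open>R\<close>. The second alternative fails at \<open>m\<close>.\<close>
  have "(\<exists>r\<in>R. \<forall>u\<in>R - {r}. (r, w) \<in> rtrancl_on (V - {u}) E) \<or>
    x \<notin> M \<union> R \<and> (\<forall>u\<in>R. (x, w) \<in> rtrancl_on (V - {u}) E)"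
    if "(x, w) \<in> rtrancl_on V E" for x
    using that
  proof (induction rule: converse_rtrancl_on_induct)
    case base
    then show ?case using assms(3) False by auto
  next
    case (step x y)
    show ?case
    proof (cases "\<exists>r\<in>R. \<forall>u\<in>R - {r}. (r, w) \<in> rtrancl_on (V - {u}) E")
      case False
      then have y: "y \<notin> M \<union> R" "\<And>u. u \<in> R \<Longrightarrow> (y, w) \<in> rtrancl_on (V - {u}) E"
        using step by auto
      then have "x \<notin> M" using step(1) assms(4) by auto
      have "(x, w) \<in> rtrancl_on (V - {u}) E" if "u \<in> R" "u \<noteq> x" for u
        using that step y(2)[OF that(1)] by (intro converse_rtrancl_on_into_rtrancl_on[of x y]) auto
      then show ?thesis using False \<open>x \<notin> M\<close> by (cases "x \<in> R") auto
    qed simp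
  qed
  from this[OF assms(1)] show ?thesis using assms(2) False by auto
qed

section \<open>Thin arcs and degree counting\<close>

definition thin_arc :: "'a rel \<Rightarrow> 'a \<Rightarrow> 'a \<Rightarrow> bool" where
  "thin_arc E g f \<longleftrightarrow> E `` {g} = {f} \<and> E\<inverse> `` {f} = {g}"

text \<open>The only in-neighbour of \<open>f\<close> lies in \<open>G\<close>, so every neighbour
  outside \<open>G\<close> is an out-neighbour. For the converse relation this bounds
  in-degrees.\<close>

lemma out_degree_bound:
  assumes "finite V" "E \<subseteq> V \<times> V" "E\<inverse> `` {f} = {g}" "g \<in> G" "finite G"
    "card V + 2 \<le> 2 * card (nbrs E f)"
  shows "card V + 2 \<le> 2 * (card (E `` {f} - G) + card G)"
proof -
  have fin: "finite (E `` {f})" using assms(1,2) by (auto intro: finite_subset)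
  have "nbrs E f \<subseteq> (E `` {f} - G) \<union> G" using assms by (auto simp: nbrs_def)
  then have "card (nbrs E f) \<le> card (E `` {f} - G) + card G"
    using fin assms(5) by (meson card_Un_le card_mono finite_Diff finite_UnI le_trans)
  with assms(6) show ?thesis by presburger
qed

locale dense_strong =
  fixes V :: "'a set" and E :: "'a rel"
  assumes finV: "finite V" and EV: "E \<subseteq> V \<times> V" and irr: "(x, x) \<notin> E"
    and strongV: "strong E V"
    and deg: "v \<in> V \<Longrightarrow> card V + 2 \<le> 2 * card (nbrs E v)"
begin

lemma nbrs_sub: "v \<in> V \<Longrightarrow> nbrs E v \<subseteq> V - {v}"
  using EV irr by (auto simp: nbrs_def)

text \<open>A degree is at most n - 1, which with the lower bound (n+2)/2 gives n \<ge> 4; then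
  (n+2)/2 \<ge> 3.\<close>

lemma deg_gt_2:
  assumes "v \<in> V" shows "2 < card (nbrs E v)"
proof -
  have "card (nbrs E v) \<le> card V - 1"
    using nbrs_sub[OF assms] finV assms by (metis card_Diff_singleton card_mono finite_Diff)
  moreover have "card V > 0" using assms finV by (auto simp: card_gt_0_iff)
  ultimately show ?thesis using deg[OF assms] by presburger
qed

section \<open>Complements of maximal proper strong sets\<close>

lemma maximal_strong_subset:
  assumes S: "S \<noteq> {}" "S \<subset> V" "strong E S"
    and max: "\<And>X. S \<subset> X \<Longrightarrow> X \<subseteq> V \<Longrightarrow> strong E X \<Longrightarrow> X = V"
  shows "(\<exists>u\<in>V. S = V - {u}) \<or> (\<exists>g\<in>V - S. \<exists>f\<in>V - S. thin_arc E g f)"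
proof -
  obtain q0 where "ear E V S q0" using ear_exists[OF strongV, of S] S by auto
  then obtain p where p: "ear E V S p" "\<forall>q. ear E V S q \<longrightarrow> length p \<le> length q"
    using ex_has_least_nat[of "ear E V S" q0 length] by blast
  note inner = shortest_ear_inner[OF p]
  have pne: "p \<noteq> []" and pV: "set p \<subseteq> V - S" using p(1) by (auto simp: ear_def)
  have "S \<union> set p = V"
    using pne pV S(2) by (intro max ear_strong[OF S(3) p(1)]) (auto simp: neq_Nil_conv)
  then have VS: "V - S = set p" using pV by auto
  have short: "length p \<le> 2"
  proof (rule ccontr)
    assume "\<not> length p \<le> 2"
    then obtain a b c q where pq: "p = a # b # c # q"
      by (metis Suc_le_length_iff not_less_eq_eq numeral_2_eq_2)
    \<comment> \<open>Since the list may repeat vertices, \<open>b\<close> could still equal the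
      first or the last one; then dropping \<open>a\<close>, or all that follows \<open>b\<close>,
      gives a shorter ear.\<close>
    have b: "b \<notin> nbrs E s" if "s \<in> S" for s
    proof
      assume "b \<in> nbrs E s"
      with inner[of b s] that have "b = hd p \<or> b = last p"
        by (auto simp: nbrs_def pq)
      then show False
      proof
        assume "b = hd p"
        then have "ear E V S (b # c # q)" using p(1) by (auto simp: ear_def pq)
        with p(2) show False by (auto simp: pq)
      next
        assume "b = last p"
        then have "ear E V S [a, b]" using p(1) by (auto simp: ear_def pq)
        with p(2) show False by (auto simp: pq)
      qed
    qed
    have fin: "finite S" "finite (set p)" using S finV finite_subset by auto
    have bV: "b \<in> V" using pV by (auto simp: pq)
    have "nbrs E b \<subseteq> set p - {b}"
      using nbrs_sub[OF bV] b VS by (auto simp: nbrs_def)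
    then have 1: "card (nbrs E b) \<le> card (set p) - 1"
      by (metis card_Diff_singleton card_mono fin(2) finite_Diff list.set_intros pq)
    obtain s where s: "s \<in> S" using S by auto
    then have sV: "s \<in> V" using S by auto
    have "nbrs E s \<subseteq> (S - {s}) \<union> {hd p, last p}"
    proof
      fix x assume x: "x \<in> nbrs E s"
      show "x \<in> (S - {s}) \<union> {hd p, last p}"
      proof (cases "x \<in> S")
        case True then show ?thesis using x nbrs_sub[OF sV] by auto
      next
        case False
        then have "x \<in> set p" using x nbrs_sub[OF sV] VS by auto
        with inner[OF this s] x show ?thesis by (auto simp: nbrs_def)
      qed
    qed
    then have "card (nbrs E s) \<le> card ((S - {s}) \<union> {hd p, last p})"
      using fin by (intro card_mono) auto
    also have "\<dots> \<le> card (S - {s}) + card {hd p, last p}" by (rule card_Un_le)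
    also have "\<dots> \<le> card S - 1 + 2" using s fin by (simp add: card_insert_if)
    finally have 2: "card (nbrs E s) \<le> card S - 1 + 2" .
    have "card V = card S + card (set p)"
      using card_Un_disjoint[OF fin] VS S(2) \<open>S \<union> set p = V\<close> by auto
    \<comment> \<open>The degrees of \<open>b\<close> and \<open>s\<close> add up to at most |V - S|
      - 1 + |S| + 1 = n, but the degree condition asks for at least n + 2.\<close>
    moreover have "card S > 0" "card (set p) > 0" using s fin by (auto simp: card_gt_0_iff pq)
    ultimately show False using 1 2 deg[OF bV] deg[OF sV] by presburger
  qed
  show ?thesis
  proof (cases "length p = 1")
    case True
    then obtain a where "p = [a]" by (auto simp: length_Suc_conv)
    then have "a \<in> V" "S = V - {a}" using VS S(2) by auto
    then show ?thesis by auto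
  next
    case False
    with short pne obtain g f where gf: "p = [g, f]"
      by (cases p; cases "tl p") (auto simp: Suc_le_eq)
    have "g \<noteq> f"
    proof
      assume "g = f"
      then show False using irr p(1) by (auto simp: gf ear_def)
    qed
    have "(g, f) \<in> E" using p(1) by (auto simp: ear_def gf)
    \<comment> \<open>An arc from \<open>g\<close> into \<open>S\<close> would make \<open>g\<close>
      the last vertex of the ear, which is \<open>f\<close>.\<close>
    moreover have "x = f" if "(g, x) \<in> E" for x
    proof -
      have "x \<in> S \<union> {g, f}" using that EV VS by (auto simp: gf)
      then show ?thesis using that inner(2)[of g x] irr[of g] \<open>g \<noteq> f\<close> by (auto simp: gf)
    qed
    moreover have "x = g" if "(x, f) \<in> E" for x
    proof -
      have "x \<in> S \<union> {g, f}" using that EV VS by (auto simp: gf)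
      then show ?thesis using that inner(1)[of f x] irr[of f] \<open>g \<noteq> f\<close> by (auto simp: gf)
    qed
    ultimately have "thin_arc E g f" unfolding thin_arc_def by blast
    moreover have "g \<in> V - S" "f \<in> V - S" unfolding VS gf by simp_all
    ultimately show ?thesis by blast
  qed
qed

text \<open>Enlarge \<open>X\<close> to a maximal proper strong set; what that set misses is also
  missed by \<open>X\<close>.\<close>

lemma noncritical_or_thin_arc:
  assumes "X \<noteq> {}" "X \<subset> V" "strong E X"
  shows "(\<exists>u\<in>V - X. strong E (V - {u})) \<or> (\<exists>g\<in>V - X. \<exists>f\<in>V - X. thin_arc E g f)"
proof -
  define P where "P = (\<lambda>Y. X \<subseteq> Y \<and> Y \<subset> V \<and> strong E Y)"
  have "finite {Y. P Y}" using finV by (auto simp: P_def intro: finite_subset[of _ "Pow V"])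
  moreover have "X \<in> {Y. P Y}" using assms by (auto simp: P_def)
  ultimately obtain S where S: "P S" "\<And>Y. P Y \<Longrightarrow> S \<subseteq> Y \<Longrightarrow> S = Y"
    using finite_has_maximal2[of "{Y. P Y}" X] by auto
  have "(\<exists>u\<in>V. S = V - {u}) \<or> (\<exists>g\<in>V - S. \<exists>f\<in>V - S. thin_arc E g f)"
  proof (rule maximal_strong_subset)
    show "Y = V" if "S \<subset> Y" "Y \<subseteq> V" "strong E Y" for Y
      using S(2)[of Y] S(1) that by (auto simp: P_def)
  qed (use S(1) assms in \<open>auto simp: P_def\<close>)
  moreover have "V - S \<subseteq> V - X" "strong E S" using S(1) by (auto simp: P_def)
  ultimately show ?thesis by blast
qed

section \<open>A noncritical vertex different from a prescribed one\<close>

lemma second_noncritical: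
  assumes w: "w \<in> V"
  shows "\<exists>u\<in>V - {w}. strong E (V - {u})"
proof -
  define P where "P = {(g, f). thin_arc E g f \<and> g \<noteq> w \<and> f \<noteq> w}"
  define F where "F = snd ` P"
  define G where "G = fst ` P"
  define R where "R = V - F - G"
  have PE: "P \<subseteq> E" by (auto simp: P_def thin_arc_def)
  have finP: "finite P" using PE EV finV by (meson finite_SigmaI finite_subset)
  have finFG: "finite F" "finite G" using finP by (auto simp: F_def G_def)
  \<comment> \<open>Either end of a thin arc determines the other.\<close>
  have "inj_on snd P" "inj_on fst P" by (auto simp: inj_on_def P_def thin_arc_def)
  then have cFG: "card F = card P" "card G = card P" by (auto simp: F_def G_def card_image)
  have FGV: "F \<subseteq> V" "G \<subseteq> V" using PE EV by (auto simp: F_def G_def)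
  \<comment> \<open>A vertex that is head of one thin arc and tail of another has at most two
    neighbours.\<close>
  have disj: "F \<inter> G = {}"
  proof (rule ccontr)
    assume "F \<inter> G \<noteq> {}"
    then obtain x a b where x: "(a, x) \<in> P" "(x, b) \<in> P" by (auto simp: F_def G_def)
    then have "nbrs E x = {a, b}" by (auto simp: P_def thin_arc_def nbrs_def)
    moreover have "card {a, b} \<le> 2" by (simp add: card_insert_if)
    ultimately show False using deg_gt_2[of x] x PE EV by auto
  qed
  have wFG: "w \<notin> F" "w \<notin> G" by (auto simp: F_def G_def P_def)
  have wR: "w \<in> R" using w wFG by (auto simp: R_def)
  have finR: "finite R" using finV by (simp add: R_def)
  have "card (F \<union> G) = 2 * card P" using disj finFG cFG by (simp add: card_Un_disjoint)
  moreover have "card V = card (R \<union> (F \<union> G))"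
    using FGV by (intro arg_cong[of _ _ card]) (auto simp: R_def)
  moreover have "card (R \<union> (F \<union> G)) = card R + card (F \<union> G)"
    using finR finFG by (intro card_Un_disjoint) (auto simp: R_def)
  ultimately have cR: "card V = card R + 2 * card P" by simp
  have mateF: "\<exists>g\<in>G. E\<inverse> `` {f} = {g} \<and> E `` {g} = {f}" if "f \<in> F" for f
    using that by (force simp: F_def G_def P_def thin_arc_def)
  have mateG: "\<exists>f\<in>F. E\<inverse> `` {f} = {g} \<and> E `` {g} = {f}" if "g \<in> G" for g
    using that by (force simp: F_def G_def P_def thin_arc_def)
  define A where "A f = E `` {f} - G" for f
  define B where "B g = E\<inverse> `` {g} - F" for g
  have A: "A f \<subseteq> R" "card V + 2 \<le> 2 * (card (A f) + card P)" if fF: "f \<in> F" for f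
  proof -
    obtain g where g: "g \<in> G" "E\<inverse> `` {f} = {g}" using mateF[OF fF] by metis
    show "card V + 2 \<le> 2 * (card (A f) + card P)"
      using out_degree_bound[OF finV EV g(2,1) finFG(2)] deg[of f] fF FGV cFG by (auto simp: A_def)
    \<comment> \<open>The only arc into a vertex of \<open>F\<close> comes from \<open>G\<close>,
      and \<open>f\<close> is not in \<open>G\<close>.\<close>
    have "x \<notin> F" if "(f, x) \<in> E" for x
    proof
      assume "x \<in> F"
      then obtain h where "h \<in> G" "E\<inverse> `` {x} = {h}" using mateF[of x] by metis
      moreover have "f \<in> E\<inverse> `` {x}" using that by simp
      ultimately have "f \<in> G" by simp
      with fF disj show False by auto
    qed
    then show "A f \<subseteq> R" using EV by (auto simp: A_def R_def)
  qed
  have B: "B g \<subseteq> R" "card V + 2 \<le> 2 * (card (B g) + card P)" if gG: "g \<in> G" for g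
  proof -
    obtain f where f: "f \<in> F" "E `` {g} = {f}" using mateG[OF gG] by metis
    show "card V + 2 \<le> 2 * (card (B g) + card P)"
      using out_degree_bound[of V "E\<inverse>" g f F] finV EV f finFG deg[of g] gG FGV cFG
      by (auto simp: B_def nbrs_converse)
    have "x \<notin> G" if "(x, g) \<in> E" for x
    proof
      assume "x \<in> G"
      then obtain h where "h \<in> F" "E `` {x} = {h}" using mateG[of x] by metis
      moreover have "g \<in> E `` {x}" using that by simp
      ultimately have "g \<in> F" by simp
      with gG disj show False by auto
    qed
    then show "B g \<subseteq> R" using EV by (auto simp: B_def R_def)
  qed
  \<comment> \<open>With |V| = |R| + 2|P|, each of \<open>A f\<close> and \<open>B g\<close> has at
    least |R|/2 + 1 elements. Taking \<open>Q\<close> as \<open>R\<close> gives two common elements;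
    as \<open>R\<close> without \<open>w\<close>, three.\<close>
  have common: "card R + 2 \<le> card (A f \<inter> B g) + card Q"
    if "f \<in> F" "g \<in> G" "A f \<union> B g \<subseteq> Q" "Q \<subseteq> R" for f g Q
  proof -
    have "finite Q" by (rule finite_subset[OF that(4) finR])
    have "finite (A f)" "finite (B g)"
      by (rule finite_subset[OF A(1)[OF that(1)] finR], rule finite_subset[OF B(1)[OF that(2)] finR])
    then have "card (A f) + card (B g) = card (A f \<union> B g) + card (A f \<inter> B g)"
      by (rule card_Un_Int)
    moreover have "card (A f \<union> B g) \<le> card Q" using that(3) \<open>finite Q\<close> by (rule card_mono[rotated])
    ultimately show ?thesis using A(2)[OF that(1)] B(2)[OF that(2)] cR
      by presburger
  qed
  \<comment> \<open>A thin arc with both ends outside \<open>X\<close> avoids \<open>w\<close>, so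
    its head would lie in \<open>F\<close>, hence in \<open>X\<close>.\<close>
  have noncritical_outside: "\<exists>u\<in>V - X. strong E (V - {u})"
    if X: "w \<in> X" "F \<subseteq> X" "X \<subset> V" "strong E X" for X
  proof (rule ccontr)
    assume "\<not> ?thesis"
    then obtain g f where "g \<notin> X" "f \<notin> X" "thin_arc E g f"
      using noncritical_or_thin_arc[of X] X by auto
    moreover from this have "f \<in> F" using X(1) by (force simp: F_def P_def)
    ultimately show False using X(2) by auto
  qed
  show ?thesis
  proof (cases "P = {}")
    case True
    have "2 < card (nbrs E w)" using deg_gt_2[OF w] .
    then have "nbrs E w \<noteq> {}" by auto
    then have "V \<noteq> {w}" using nbrs_sub[OF w] by auto
    with noncritical_outside[of "{w}"] True w show ?thesis by (auto simp: F_def strong_def)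
  next
    case False
    then obtain f g where fg: "f \<in> F" "g \<in> G" by (auto simp: F_def G_def)
    define M where "M = F \<union> G"
    have MV: "M \<subseteq> V" using FGV by (simp add: M_def)
    \<comment> \<open>Two middle vertices allow passing from any head to any tail despite the loss
      of \<open>u\<close>. A walk starting in \<open>G\<close> first follows its thin arc; one
      ending in \<open>F\<close> arrives along a thin arc.\<close>
    have core: "(x, y) \<in> rtrancl_on (V - {u}) E" if u: "u \<in> R" and xy: "x \<in> M" "y \<in> M" for u x y
    proof -
      have MVu: "M \<subseteq> V - {u}" using MV u by (auto simp: M_def R_def)
      have FG: "(a, b) \<in> rtrancl_on (V - {u}) E" if "a \<in> F" "b \<in> G" for a b
      proof -
        have "2 \<le> card (A a \<inter> B b)"
          using common[OF that, of R] A(1)[OF that(1)] B(1)[OF that(2)] by auto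
        then have "\<not> A a \<inter> B b \<subseteq> {u}"
          using card_mono[of "{u}" "A a \<inter> B b"] by auto
        then obtain k where "k \<in> A a \<inter> B b" "k \<noteq> u" by auto
        then have "(a, k) \<in> E" "(k, b) \<in> E" "k \<in> V - {u}" using EV by (auto simp: A_def B_def)
        then show ?thesis using that MVu
          by (intro rtrancl_on_trans[OF rtrancl_on_edge[of a k] rtrancl_on_edge[of k b]])
            (auto simp: M_def)
      qed
      have MG: "(a, b) \<in> rtrancl_on (V - {u}) E" if aM: "a \<in> M" and bG: "b \<in> G" for a b
      proof (cases "a \<in> F")
        case False
        then have "a \<in> G" using aM by (simp add: M_def)
        then obtain f' where f': "f' \<in> F" "E `` {a} = {f'}" using mateG by metis
        show ?thesis
        proof (rule converse_rtrancl_on_into_rtrancl_on)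
          show "(a, f') \<in> E" using f'(2) by blast
        qed (use FG[OF f'(1) bG] MVu aM in auto)
      qed (use FG bG in auto)
      show ?thesis
      proof (cases "y \<in> G")
        case False
        then have "y \<in> F" using xy by (simp add: M_def)
        then obtain g' where g': "g' \<in> G" "E\<inverse> `` {y} = {g'}" using mateF by metis
        show ?thesis
        proof (rule rtrancl_on_into_rtrancl_on)
          show "(g', y) \<in> E" using g'(2) by blast
        qed (use MG[OF xy(1) g'(1)] MVu xy in auto)
      qed (use MG xy in auto)
    qed
    define R1 where "R1 = E `` F - M"
    define R2 where "R2 = E\<inverse> `` G - M"
    have wM: "w \<notin> M" using wFG by (auto simp: M_def)
    \<comment> \<open>A vertex of \<open>G\<close> has only its thin arc going out, so walks leave
      \<open>M\<close> from \<open>F\<close>; dually they enter \<open>M\<close> through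
      \<open>G\<close>.\<close>
    have outM: "E `` M \<subseteq> M \<union> R1" using mateG by (force simp: M_def R1_def)
    have inM: "E\<inverse> `` M \<subseteq> M \<union> R2" using mateF by (force simp: M_def R2_def)
    have fV: "f \<in> V" "f \<in> M" using fg FGV by (auto simp: M_def)
    have "(f, w) \<in> rtrancl_on V E" "(w, f) \<in> rtrancl_on V E"
      using strongV fV w by (auto simp: strong_def)
    \<comment> \<open>Within \<open>R1\<close> only \<open>r1\<close> can block the way to
      \<open>w\<close>; for \<open>r2\<close> the same argument runs in the converse
      digraph.\<close>
    then obtain r1 r2 where r1: "r1 \<in> R1" "w \<in> R1 \<longrightarrow> r1 = w"
        "\<And>u. u \<in> R1 - {r1} \<Longrightarrow> (r1, w) \<in> rtrancl_on (V - {u}) E"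
      and r2: "r2 \<in> R2" "w \<in> R2 \<longrightarrow> r2 = w"
        "\<And>u. u \<in> R2 - {r2} \<Longrightarrow> (w, r2) \<in> rtrancl_on (V - {u}) E"
      using reach_avoiding[OF _ fV(2) wM outM, of V]
        reach_avoiding[OF _ fV(2) wM inM, of V] rtrancl_on_converse_iff[of _ _ _ E]
      by metis
    define K where "K = A f \<inter> B g"
    have KR: "K \<subseteq> R1 \<inter> R2" "K \<subseteq> R"
      using A(1)[OF fg(1)] B(1)[OF fg(2)] fg by (auto simp: K_def A_def B_def R1_def R2_def M_def R_def)
    have K2: "2 \<le> card K"
      using common[OF fg, of R] A(1)[OF fg(1)] B(1)[OF fg(2)] by (auto simp: K_def)
    have K3: "3 \<le> card K" if "w \<notin> R1" "w \<notin> R2"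
    proof -
      have "w \<notin> A f" "w \<notin> B g" using that fg wM by (auto simp: A_def B_def R1_def R2_def)
      then have "card R + 2 \<le> card K + card (R - {w})"
        unfolding K_def using A(1)[OF fg(1)] B(1)[OF fg(2)] by (intro common[OF fg]) auto
      moreover have "card R = Suc (card (R - {w}))" using finR wR by (rule card.remove)
      ultimately show ?thesis by presburger
    qed
    \<comment> \<open>If \<open>w\<close> lies in \<open>R1\<close> or \<open>R2\<close>, then
      \<open>r1\<close> or \<open>r2\<close> equals \<open>w\<close>, and at most one element of
      \<open>K\<close> is forbidden. Otherwise \<open>w\<close> is not in \<open>K\<close> and at
      most two of at least three are.\<close>
    have "\<not> K \<subseteq> {r1, r2, w}"
    proof
      assume K: "K \<subseteq> {r1, r2, w}"
      have card2: "card {r1, r2} \<le> 2" by (simp add: card_insert_if)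
      consider "w \<in> R1" "w \<in> R2" | "w \<in> R1" "w \<notin> R2" | "w \<notin> R1" "w \<in> R2" | "w \<notin> R1" "w \<notin> R2" by auto
      then show False
      proof cases
        case 1
        then have "K \<subseteq> {w}" using K r1(2) r2(2) by auto
        then have "card K \<le> 1" using card_mono[of "{w}" K] by simp
        with K2 show False by simp
      next
        case 2
        then have "K \<subseteq> {r2}" using K r1(2) KR by auto
        then have "card K \<le> 1" using card_mono[of "{r2}" K] by simp
        with K2 show False by simp
      next
        case 3
        then have "K \<subseteq> {r1}" using K r2(2) KR by auto
        then have "card K \<le> 1" using card_mono[of "{r1}" K] by simp
        with K2 show False by simp
      next
        case 4
        then have "K \<subseteq> {r1, r2}" using K KR by auto
        then have "card K \<le> 2" using card_mono[of "{r1, r2}" K] card2 by simp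
        with K3 4 show False by simp
      qed
    qed
    then obtain u where u: "u \<in> K" "u \<noteq> r1" "u \<noteq> r2" "u \<noteq> w" by auto
    have uR: "u \<in> R" using u KR by auto
    then have uV: "u \<in> V" "u \<notin> M" by (auto simp: R_def M_def)
    have "(f, w) \<in> rtrancl_on (V - {u}) E"
    proof -
      obtain a where a: "a \<in> F" "(a, r1) \<in> E" using r1(1) by (auto simp: R1_def)
      have "(r1, w) \<in> rtrancl_on (V - {u}) E" using r1(3)[of u] u KR by auto
      moreover have "a \<in> M" "a \<in> V - {u}" using a uV MV by (auto simp: M_def)
      ultimately show ?thesis
        using core[OF uR fV(2), of a] a(2)
        by (meson converse_rtrancl_on_into_rtrancl_on rtrancl_on_trans)
    qed
    moreover have "(w, f) \<in> rtrancl_on (V - {u}) E"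
    proof -
      obtain b where b: "b \<in> G" "(r2, b) \<in> E" using r2(1) by (auto simp: R2_def)
      have "(w, r2) \<in> rtrancl_on (V - {u}) E" using r2(3)[of u] u KR by auto
      moreover have "b \<in> M" "b \<in> V - {u}" using b uV MV by (auto simp: M_def)
      ultimately show ?thesis
        using core[OF uR _ fV(2), of b] b(2) by (meson rtrancl_on_into_rtrancl_on rtrancl_on_trans)
    qed
    \<comment> \<open>Deleting \<open>u\<close> only serves to make this component a proper subset;
      the noncritical vertex found outside it may be another one.\<close>
    moreover define X where
      "X = {x. (f, x) \<in> rtrancl_on (V - {u}) E \<and> (x, f) \<in> rtrancl_on (V - {u}) E}"
    ultimately have "w \<in> X" by simp
    moreover have "F \<subseteq> X" using core[OF uR fV(2)] core[OF uR _ fV(2)] by (auto simp: X_def M_def)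
    moreover have "X \<subseteq> V - {u}" unfolding X_def by (blast dest: in_rtrancl_on_in_F(2))
    then have "X \<subset> V" using uV by blast
    moreover have "strong E X"
      unfolding X_def by (rule strong_component) (use fV uV in auto)
    ultimately show ?thesis using noncritical_outside[of X] by auto
  qed
qed

end

section \<open>Transfer to library digraphs\<close>

lemma strongly_connected_iff:
  "strongly_connected D \<longleftrightarrow> verts D \<noteq> {} \<and> strong (arcs_ends D) (verts D)"
  unfolding strongly_connected_def strong_def reachable_def ..

text \<open>Walks confined to the remaining vertices never use an arc at \<open>v\<close>, so the
  original arcs can be kept.\<close>

lemma rtrancl_on_del_vert:
  "rtrancl_on (verts D - {v}) (arcs_ends (pre_digraph.del_vert D v)) =
   rtrancl_on (verts D - {v}) (arcs_ends D)" (is "?L = ?R")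
proof (intro equalityI subrelI)
  fix x y assume "(x, y) \<in> ?R"
  then show "(x, y) \<in> ?L"
  proof (induction rule: rtrancl_on_induct)
    case base
    then show ?case by (rule rtrancl_on_refl)
  next
    case (step y z)
    then have "(y, z) \<in> arcs_ends (pre_digraph.del_vert D v)"
      by (auto simp: arcs_ends_conv pre_digraph.del_vert_simps)
    from rtrancl_on_into_rtrancl_on[OF step.IH this step.hyps(4)] show ?case .
  qed
next
  fix x y assume "(x, y) \<in> ?L"
  moreover have "arcs_ends (pre_digraph.del_vert D v) \<subseteq> arcs_ends D"
    by (auto simp: arcs_ends_conv pre_digraph.del_vert_simps)
  ultimately show "(x, y) \<in> ?R" by (metis rtrancl_on_mono subset_refl)
qed

theorem corollary3:
  fixes D :: "('a, 'b) pre_digraph" and n :: nat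
  assumes "digraph D"
    and "strongly_connected D"
    and "n = card (verts D)"
    and "n \<ge> 4"
    and "\<And>v. v \<in> verts D \<Longrightarrow> real (vdegree D v) \<ge> (real n + 2) / 2"
  shows "card {v \<in> verts D. noncritical D v} \<ge> 2"
proof -
  interpret digraph D by fact
  have ends: "arcs_ends D \<subseteq> verts D \<times> verts D" by (auto simp: arcs_ends_conv)
  have loop: "(x, x) \<notin> arcs_ends D" for x using adj_not_same by blast
  interpret dense_strong "verts D" "arcs_ends D"
  proof
    show "card (verts D) + 2 \<le> 2 * card (nbrs (arcs_ends D) v)" if "v \<in> verts D" for v
    proof -
      have "{y \<in> verts D. adjacent D v y} = nbrs (arcs_ends D) v"
        using ends loop by (auto simp: adjacent_def nbrs_def)
      then have "real (card (nbrs (arcs_ends D) v)) \<ge> (real (card (verts D)) + 2) / 2"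
        using assms(3) assms(5)[OF that] by (simp add: vdegree_def)
      then have "real (card (verts D) + 2) \<le> real (2 * card (nbrs (arcs_ends D) v))" by simp
      then show ?thesis by (simp only: of_nat_le_iff)
    qed
  qed (use ends loop assms(2) strongly_connected_iff[of D] in auto)
  \<comment> \<open>The vertex \<open>w\<close> survives the deletion of \<open>u\<close>, which
    gives the nonemptiness that strong connectedness includes.\<close>
  have nc: "noncritical D u" if "w \<in> verts D" "u \<in> verts D - {w}"
    "strong (arcs_ends D) (verts D - {u})" for u w
    using that by (auto simp: noncritical_def strongly_connected_iff strong_def
      pre_digraph.verts_del_vert rtrancl_on_del_vert)
  obtain w where w: "w \<in> verts D" using assms(2) by (auto simp: strongly_connected_def)
  obtain u where u: "u \<in> verts D" "noncritical D u"
    using second_noncritical[OF w] nc[OF w] by auto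
  \<comment> \<open>The first vertex found is now the one to be avoided, so the second is
    different.\<close>
  obtain v where v: "v \<in> verts D" "noncritical D v" "v \<noteq> u"
    using second_noncritical[OF u(1)] nc[OF u(1)] by auto
  have "card {u, v} \<le> card {v \<in> verts D. noncritical D v}"
    using u v by (intro card_mono) auto
  with v(3) show ?thesis by simp
qed

end
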